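(* Let $\mathfrak{H}$ and $\mathcal{H}$ be Hilbert spaces, let $A$ be a closed symmetric linear relation in $\mathfrak{H}$, let $(\mathcal{H},\Gamma)$ be an essentially unitary boundary pair for $A^*$ with Weyl family $M_\Gamma$, and assume in addition that $M_\Gamma(z)\in B(\mathcal{H})$ for all $z\in\mathbb{C}\setminus\mathbb{R}$. Let $M_{\overline{\Gamma}}$ be the Weyl family corresponding to the unitary boundary pair $(\mathcal{H},\overline{\Gamma})$ for $A^*$. Then $M_\Gamma=M_{\overline{\Gamma}}$, and this Weyl function belongs to the class $\mathcal{R}[\mathcal{H}]$ of Nevanlinna functions.
   Context: Scalar products are conjugate-linear in the first argument. A linear relation from $X$ to $Y$ is a linear subspace of $X\times Y$; operators are identified with their graphs; $\operatorname{dom},\operatorname{ran},\ker,\operatorname{mul}$ denote domain, range, kernel and multivalued part; $\Gamma^{-1}=\{(y,x):(x,y)\in\Gamma\}$; for a subset $X_0\subseteq X$, $\Gamma(X_0)=\{y:\exists x\in X_0,\ (x,y)\in\Gamma\}$. The overbar on a relation denotes its closure in the Hilbert space topology. For a linear relation $T$ in a Hilbert space $\mathfrak{H}$ (a subspace of $\mathfrak{H}^2=\mathfrak{H}\times\mathfrak{H}$), $T^*=\{(g,g')\in\mathfrak{H}^2:\langle f,g'\rangle=\langle f',g\rangle\ \forall (f,f')\in T\}$; $T$ is symmetric if $T\subseteq T^*$. $B(\mathcal{H})$ is the set of bounded everywhere defined operators in $\mathcal{H}$. Krein space structure: for $\hat f=(f,f')$, $\hat g=(g,g')$ in $\mathfrak{H}^2$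 put $[\hat f,\hat g]_{\mathfrak{H}^2}=-i(\langle f,g'\rangle_{\mathfrak{H}}-\langle f',g\rangle_{\mathfrak{H}})$, and similarly on $\mathcal{H}^2$. For a linear relation $\Gamma\subseteq\mathfrak{H}^2\times\mathcal{H}^2$ the Krein space adjoint is $$\Gamma^{[*]}=\{(\hat k,\hat g)\in\mathcal{H}^2\times\mathfrak{H}^2:\ [\hat f,\hat g]_{\mathfrak{H}^2}=[\hat h,\hat k]_{\mathcal{H}^2}\ \forall(\hat f,\hat h)\in\Gamma\}.$$ $\Gamma$ is isometric if $\Gamma^{-1}\subseteq\Gamma^{[*]}$, unitary if $\Gamma^{-1}=\Gamma^{[*]}$, and essentially unitary if $\overline{\Gamma}^{\,-1}=\Gamma^{[*]}$. Boundary pairs: let $A$ be a closed symmetric linear relation in $\mathfrak{H}$. The pair $(\mathcal{H},\Gamma)$ is an isometric (resp. unitary, essentially unitary) boundary pair for $A^*$ if $A_*:=\operatorname{dom}\Gamma\subseteq A^*$ is dense in $A^*$ (in the topology of $\mathfrak{H}^2$) and $\Gamma$ is isometric (resp. unitary, essentially unitary). If $(\mathcal{H},\Gamma)$ is essentially unitary then $(\mathcal{H},\overline{\Gamma})$ is a unitary boundary pair for $A^*$. Weyl family: for a relation $T$ in $\mathfrak{H}$, $\mathfrak{N}_z(T)=\ker(T-z)$ and $\widehat{\mathfrak{N}}_z(T)=\{(f_z,zf_z): f_z\in\mathfrak{N}_z(T)\}$. The Weyl family corresponding to an isometric boundary pair $(\mathcal{H},\Gamma)$ is $M_\Gamma(z)=\Gamma(\widehat{\mathfrak{N}}_z(\operatorname{dom}\Gamma))$,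 $z\in\mathbb{C}\setminus\mathbb{R}$; when its members are operators it is called the Weyl function. Nevanlinna families: a family $M(z)$, $z\in\mathbb{C}\setminus\mathbb{R}$, of linear relations in $\mathcal{H}$ belongs to the class $\widetilde{\mathcal{R}}(\mathcal{H})$ of Nevanlinna families if: (a) for $\operatorname{Im}z>0$ (resp. $\operatorname{Im}z<0$) the relation $M(z)$ is maximal dissipative (resp. maximal accumulative), and for $w\in\mathbb{C}_+$ (resp. $w\in\mathbb{C}_-$) the operator family $(M(z)+w)^{-1}\in B(\mathcal{H})$ is analytic in $z$; (b) $M(z)^*=M(\bar z)$. Here a relation $M$ in $\mathcal{H}$ is dissipative (accumulative) if $\operatorname{Im}\langle h,h'\rangle\ge0$ ($\le0$) for all $(h,h')\in M$, and maximal if it has no proper dissipative (accumulative) extension; $\mathbb{C}_\pm=\{z:\pm\operatorname{Im}z>0\}$. The class $\mathcal{R}[\mathcal{H}]$ consists of those $M\in\widetilde{\mathcal{R}}(\mathcal{H})$ with each $M(z)$ an operator and $\operatorname{dom}M(z)=\mathcal{H}$. *)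

theory Defs
  imports "HOL-Analysis.Analysis"
begin

section \<open>Complex Hilbert spaces\<close>

class complex_vector = real_vector +
  fixes scaleC :: "complex \<Rightarrow> 'a \<Rightarrow> 'a"  (infixr "*\<^sub>C" 75)
  assumes scaleC_add_right: "c *\<^sub>C (x + y) = c *\<^sub>C x + c *\<^sub>C y"
    and scaleC_add_left: "(c + d) *\<^sub>C x = c *\<^sub>C x + d *\<^sub>C x"
    and scaleC_scaleC: "c *\<^sub>C (d *\<^sub>C x) = (c * d) *\<^sub>C x"
    and scaleC_one: "1 *\<^sub>C x = x"
    and scaleR_scaleC: "r *\<^sub>R x = complex_of_real r *\<^sub>C x"

global_interpretation complex_vector: vector_space "scaleC :: complex \<Rightarrow> 'a \<Rightarrow> 'a::complex_vector"
  by unfold_locales (rule scaleC_add_right scaleC_add_left scaleC_scaleC scaleC_one)+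

text \<open>The scalar product is conjugate-linear in the first argument; its symmetry makes it so.
  Positive definiteness is part of the axiom relating it to the norm.\<close>

class complex_hilbert = complex_vector + banach +
  fixes cinner :: "'a \<Rightarrow> 'a \<Rightarrow> complex"
  assumes cinner_commute: "cinner x y = cnj (cinner y x)"
    and cinner_add_right: "cinner x (y + z) = cinner x y + cinner x z"
    and cinner_scaleC_right: "cinner x (c *\<^sub>C y) = c * cinner x y"
    and cinner_self: "cinner x x = complex_of_real ((norm x)\<^sup>2)"

instantiation complex :: complex_hilbert
begin
definition "c *\<^sub>C (x::complex) = c * x"
definition "cinner (x::complex) y = cnj x * y"
instance
  by standard
    (simp_all add: scaleC_complex_def cinner_complex_def algebra_simps scaleR_conv_of_real
      flip: complex_norm_square)
end

instantiation prod :: (complex_vector, complex_vector) complex_vector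
begin
definition "c *\<^sub>C p = (c *\<^sub>C fst p, c *\<^sub>C snd p)"
instance
  by standard
    (simp_all add: scaleC_prod_def scaleC_add_right scaleC_add_left scaleC_scaleC scaleC_one
      scaleR_prod_def scaleR_scaleC prod_eq_iff)
end

text \<open>The library's norm on a product is the one induced by this scalar product, so the library's
  \<^const>\<open>closure\<close> and \<^const>\<open>closed\<close> on products refer to the Hilbert space topology.\<close>

instantiation prod :: (complex_hilbert, complex_hilbert) complex_hilbert
begin
definition "cinner p q = cinner (fst p) (fst q) + cinner (snd p) (snd q)"
instance
proof
  fix x y z :: "'a \<times> 'b" and c :: complex
  show "cinner x y = cnj (cinner y x)"
    using cinner_commute[of "fst x" "fst y"] cinner_commute[of "snd x" "snd y"]
    by (simp add: cinner_prod_def)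
  show "cinner x (y + z) = cinner x y + cinner x z"
    by (simp add: cinner_prod_def cinner_add_right)
  show "cinner x (c *\<^sub>C y) = c * cinner x y"
    by (simp add: cinner_prod_def scaleC_prod_def cinner_scaleC_right distrib_left)
  show "cinner x x = complex_of_real ((norm x)\<^sup>2)"
    by (simp add: cinner_prod_def cinner_self norm_prod_def)
qed
end


section \<open>Linear relations\<close>

text \<open>A linear relation from \<open>X\<close> to \<open>Y\<close> is a set of pairs that is a \<^term>\<open>complex_vector.subspace\<close> of
  \<open>X \<times> Y\<close>. Domain, inverse and image are \<^const>\<open>Domain\<close>, \<^const>\<open>converse\<close> and \<^const>\<open>Image\<close>, and a
  relation with trivial multivalued part is one that is \<^const>\<open>single_valued\<close>.\<close>

abbreviation linear_relation :: "('a::complex_vector \<times> 'b::complex_vector) set \<Rightarrow> bool" where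
  "linear_relation \<equiv> complex_vector.subspace"

definition rel_add_scalar ::
    "('a::complex_vector \<times> 'a) set \<Rightarrow> complex \<Rightarrow> ('a \<times> 'a) set" where
  "rel_add_scalar T c = {(f, f' + c *\<^sub>C f) | f f'. (f, f') \<in> T}"

definition rel_ker :: "('a \<times> 'b::zero) set \<Rightarrow> 'a set" where
  "rel_ker T = {f. (f, 0) \<in> T}"

definition rel_adjoint :: "('a::complex_hilbert \<times> 'a) set \<Rightarrow> ('a \<times> 'a) set" where
  "rel_adjoint T = {(g, g'). \<forall>(f, f') \<in> T. cinner f g' = cinner f' g}"

definition symmetric_relation :: "('a::complex_hilbert \<times> 'a) set \<Rightarrow> bool" where
  "symmetric_relation T \<longleftrightarrow> T \<subseteq> rel_adjoint T"

definition bounded_clinear :: "('a::complex_hilbert \<Rightarrow> 'b::complex_hilbert) \<Rightarrow> bool" where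
  "bounded_clinear F \<longleftrightarrow> bounded_linear F \<and> (\<forall>c x. F (c *\<^sub>C x) = c *\<^sub>C F x)"

definition graph_of :: "('a \<Rightarrow> 'b) \<Rightarrow> ('a \<times> 'b) set" where
  "graph_of F = {(x, F x) | x. True}"

text \<open>The set \<open>B(\<H>)\<close>, operators being identified with their graphs.\<close>

definition bounded_operators :: "('a::complex_hilbert \<times> 'a) set set" where
  "bounded_operators = {graph_of F | F. bounded_clinear F}"


section \<open>Boundary pairs and Weyl families\<close>

definition krein :: "'a::complex_hilbert \<times> 'a \<Rightarrow> 'a \<times> 'a \<Rightarrow> complex" where
  "krein f g = - \<i> * (cinner (fst f) (snd g) - cinner (snd f) (fst g))"

definition krein_adjoint ::
    "(('a::complex_hilbert \<times> 'a) \<times> ('b::complex_hilbert \<times> 'b)) set \<Rightarrow> (('b \<times> 'b) \<times> ('a \<times> 'a)) set" where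
  "krein_adjoint \<Gamma> = {(k, g). \<forall>(f, h) \<in> \<Gamma>. krein f g = krein h k}"

definition krein_unitary ::
    "(('a::complex_hilbert \<times> 'a) \<times> ('b::complex_hilbert \<times> 'b)) set \<Rightarrow> bool" where
  "krein_unitary \<Gamma> \<longleftrightarrow> \<Gamma>\<inverse> = krein_adjoint \<Gamma>"

definition krein_essentially_unitary ::
    "(('a::complex_hilbert \<times> 'a) \<times> ('b::complex_hilbert \<times> 'b)) set \<Rightarrow> bool" where
  "krein_essentially_unitary \<Gamma> \<longleftrightarrow> (closure \<Gamma>)\<inverse> = krein_adjoint \<Gamma>"

text \<open>In a boundary pair \<open>(\<H>, \<Gamma>)\<close> for \<open>A\<^sup>*\<close>, the space \<open>\<H>\<close> is the type \<open>'b\<close>.\<close>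

definition boundary_domain_dense ::
    "('a::complex_hilbert \<times> 'a) set \<Rightarrow> (('a \<times> 'a) \<times> ('b::complex_hilbert \<times> 'b)) set \<Rightarrow> bool" where
  "boundary_domain_dense A \<Gamma> \<longleftrightarrow>
     Domain \<Gamma> \<subseteq> rel_adjoint A \<and> rel_adjoint A \<subseteq> closure (Domain \<Gamma>)"

definition unitary_boundary_pair ::
    "('a::complex_hilbert \<times> 'a) set \<Rightarrow> (('a \<times> 'a) \<times> ('b::complex_hilbert \<times> 'b)) set \<Rightarrow> bool" where
  "unitary_boundary_pair A \<Gamma> \<longleftrightarrow>
     linear_relation \<Gamma> \<and> boundary_domain_dense A \<Gamma> \<and> krein_unitary \<Gamma>"

definition essentially_unitary_boundary_pair ::
    "('a::complex_hilbert \<times> 'a) set \<Rightarrow> (('a \<times> 'a) \<times> ('b::complex_hilbert \<times> 'b)) set \<Rightarrow> bool" where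
  "essentially_unitary_boundary_pair A \<Gamma> \<longleftrightarrow>
     linear_relation \<Gamma> \<and> boundary_domain_dense A \<Gamma> \<and> krein_essentially_unitary \<Gamma>"

definition defect_space :: "('a::complex_vector \<times> 'a) set \<Rightarrow> complex \<Rightarrow> 'a set" where
  "defect_space T z = rel_ker (rel_add_scalar T (- z))"

definition defect_relation :: "('a::complex_vector \<times> 'a) set \<Rightarrow> complex \<Rightarrow> ('a \<times> 'a) set" where
  "defect_relation T z = {(f, z *\<^sub>C f) | f. f \<in> defect_space T z}"

definition weyl_family ::
    "(('a::complex_hilbert \<times> 'a) \<times> ('b::complex_hilbert \<times> 'b)) set \<Rightarrow> complex \<Rightarrow> ('b \<times> 'b) set" where
  "weyl_family \<Gamma> z = \<Gamma> `` defect_relation (Domain \<Gamma>) z"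


section \<open>The closure of an essentially unitary boundary pair is a unitary one\<close>

lemma cinner_add_left:
  fixes x y z :: "'a::complex_hilbert"
  shows "cinner (x + y) z = cinner x z + cinner y z"
  by (metis cinner_add_right cinner_commute complex_cnj_add)

lemma cinner_scaleC_left:
  fixes x y :: "'a::complex_hilbert"
  shows "cinner (c *\<^sub>C x) y = cnj c * cinner x y"
  by (metis cinner_commute cinner_scaleC_right complex_cnj_mult)

lemma cinner_scaleR_left:
  fixes x y :: "'a::complex_hilbert"
  shows "cinner (r *\<^sub>R x) y = r *\<^sub>R cinner x y"
  by (simp only: scaleR_scaleC[where 'a='a] cinner_scaleC_left complex_cnj_complex_of_real scaleR_conv_of_real)

lemma cinner_scaleR_right:
  fixes x y :: "'a::complex_hilbert"
  shows "cinner x (r *\<^sub>R y) = r *\<^sub>R cinner x y"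
  by (simp only: scaleR_scaleC[where 'a='a] cinner_scaleC_right scaleR_conv_of_real)

lemma norm_scaleC:
  fixes x :: "'a::complex_hilbert"
  shows "norm (c *\<^sub>C x) = norm c * norm x"
proof -
  have "complex_of_real ((norm (c *\<^sub>C x))\<^sup>2) = (c * cnj c) * cinner x x"
    unfolding cinner_self[symmetric] cinner_scaleC_left cinner_scaleC_right by (simp only: mult_ac)
  also have "\<dots> = complex_of_real ((norm c * norm x)\<^sup>2)"
    unfolding cinner_self complex_norm_square[symmetric] by (simp only: of_real_mult power_mult_distrib)
  finally have "(norm (c *\<^sub>C x))\<^sup>2 = (norm c * norm x)\<^sup>2"
    unfolding of_real_eq_iff .
  then show ?thesis by simp
qed

lemma Re_cinner_le:
  fixes u v :: "'a::complex_hilbert"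
  shows "2 * Re (cinner u v) \<le> (norm u)\<^sup>2 + (norm v)\<^sup>2"
proof -
  define w where "w = u + (-1) *\<^sub>R v"
  have "cinner w w = cinner u u - cinner u v - (cinner v u - cinner v v)"
    unfolding w_def cinner_add_left cinner_add_right cinner_scaleR_left cinner_scaleR_right by simp
  then have "Re (cinner w w) = Re (cinner u u) - 2 * Re (cinner u v) + Re (cinner v v)"
    using arg_cong[OF cinner_commute[of v u], of Re] by simp
  then have "(norm w)\<^sup>2 = (norm u)\<^sup>2 - 2 * Re (cinner u v) + (norm v)\<^sup>2"
    unfolding cinner_self Re_complex_of_real .
  then show ?thesis
    using zero_le_power2[of "norm w"] by linarith
qed

lemma Re_cinner_le_norm:
  fixes x y :: "'a::complex_hilbert"
  shows "Re (cinner x y) \<le> norm x * norm y"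
proof (cases "x = 0 \<or> y = 0")
  case True
  then show ?thesis
    using cinner_scaleR_left[of 0 0 y] cinner_scaleR_right[of x 0 0] by auto
next
  case False
  then have "Re (cinner x y) / (norm x * norm y) \<le> 1"
    using Re_cinner_le[of "inverse (norm x) *\<^sub>R x" "inverse (norm y) *\<^sub>R y"]
    unfolding cinner_scaleR_left cinner_scaleR_right by (simp add: divide_inverse mult_ac)
  then show ?thesis
    using False by (simp add: divide_le_eq)
qed

lemma bounded_bilinear_cinner: "bounded_bilinear (cinner :: 'a::complex_hilbert \<Rightarrow> 'a \<Rightarrow> complex)"
proof
  show "\<exists>K. \<forall>x y::'a. norm (cinner x y) \<le> norm x * norm y * K"
  proof (intro exI allI)
    fix x y :: 'a
    have "\<bar>Re (cinner x y)\<bar> \<le> norm x * norm y"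
      using Re_cinner_le_norm[of x y] Re_cinner_le_norm[of x "(-1) *\<^sub>C y"]
      unfolding cinner_scaleC_right norm_scaleC by simp
    moreover have "\<bar>Im (cinner x y)\<bar> \<le> norm x * norm y"
      using Re_cinner_le_norm[of x "\<i> *\<^sub>C y"] Re_cinner_le_norm[of x "(-\<i>) *\<^sub>C y"]
      unfolding cinner_scaleC_right norm_scaleC by simp
    ultimately show "norm (cinner x y) \<le> norm x * norm y * 2"
      using cmod_le[of "cinner x y"] by linarith
  qed
qed (rule cinner_add_left cinner_add_right cinner_scaleR_left cinner_scaleR_right)+

interpretation cinner: bounded_bilinear "cinner :: 'a::complex_hilbert \<Rightarrow> 'a \<Rightarrow> complex"
  by (rule bounded_bilinear_cinner)

lemma closed_rel_adjoint: "closed (rel_adjoint A)"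
proof -
  have "rel_adjoint A = (\<Inter>(f,f')\<in>A. {p. cinner f (snd p) = cinner f' (fst p)})"
    by (auto simp: rel_adjoint_def)
  moreover have "closed {p. cinner f (snd p) = cinner f' (fst p)}" for f f' :: 'a
    by (intro closed_Collect_eq cinner.continuous_on continuous_intros)
  ultimately show ?thesis by (auto intro!: closed_INT)
qed

lemma krein_adjoint_closure: "krein_adjoint (closure \<Gamma>) = krein_adjoint \<Gamma>"
proof
  show "krein_adjoint (closure \<Gamma>) \<subseteq> krein_adjoint \<Gamma>"
    using closure_subset[of \<Gamma>] unfolding krein_adjoint_def by blast
  show "krein_adjoint \<Gamma> \<subseteq> krein_adjoint (closure \<Gamma>)"
  proof clarify
    fix k k' g g' assume a: "((k,k'),(g,g')) \<in> krein_adjoint \<Gamma>"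
    let ?C = "{p. krein (fst p) (g,g') = krein (snd p) (k,k')}"
    have "closed ?C" unfolding krein_def
      by (intro closed_Collect_eq cinner.continuous_on continuous_intros)
    moreover have "\<Gamma> \<subseteq> ?C" using a by (auto simp: krein_adjoint_def)
    ultimately have "closure \<Gamma> \<subseteq> ?C" by (rule closure_minimal[rotated])
    then show "((k,k'),(g,g')) \<in> krein_adjoint (closure \<Gamma>)" by (force simp: krein_adjoint_def)
  qed
qed

lemma bounded_linear_scaleC: "bounded_linear (\<lambda>x::'a::complex_hilbert. c *\<^sub>C x)"
  by (rule bounded_linear_intro[of _ "norm c"])
     (simp_all add: scaleC_add_right scaleR_scaleC scaleC_scaleC norm_scaleC mult.commute)

lemma linear_relation_closure:
  assumes "linear_relation (S::('a::complex_hilbert\<times>'b::complex_hilbert) set)"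
  shows "linear_relation (closure S)"
proof (rule complex_vector.subspaceI)
  show "0 \<in> closure S" using assms closure_subset complex_vector.subspace_0 by blast
  show "x + y \<in> closure S" if "x \<in> closure S" "y \<in> closure S" for x y
  proof -
    obtain f g where f: "\<And>n. f n \<in> S" "f \<longlonglongrightarrow> x" and g: "\<And>n. g n \<in> S" "g \<longlonglongrightarrow> y"
      using \<open>x \<in> _\<close> \<open>y \<in> _\<close> unfolding closure_sequential by metis
    have "(\<lambda>n. f n + g n) \<longlonglongrightarrow> x + y" "\<And>n. f n + g n \<in> S"
      using f g by (auto intro: tendsto_add complex_vector.subspace_add[OF assms])
    then show ?thesis unfolding closure_sequential by (intro exI[of _ "\<lambda>n. f n + g n"]) auto
  qed
  show "c *\<^sub>C x \<in> closure S" if "x \<in> closure S" for c x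
    using closure_bounded_linear_image_subset[OF bounded_linear_scaleC[of c], of S] that
      closure_mono[of "(\<lambda>x. c *\<^sub>C x) ` S" S] complex_vector.subspace_scale[OF assms] by blast
qed

lemma unitary_boundary_pair_closure:
  fixes A :: "('a::complex_hilbert\<times>'a) set" and \<Gamma> :: "(('a\<times>'a)\<times>('b::complex_hilbert\<times>'b)) set"
  assumes "essentially_unitary_boundary_pair A \<Gamma>"
  shows "unitary_boundary_pair A (closure \<Gamma>)"
proof -
  have a: "Domain \<Gamma> \<subseteq> rel_adjoint A" "rel_adjoint A \<subseteq> closure (Domain \<Gamma>)"
   "linear_relation \<Gamma>" "(closure \<Gamma>)\<inverse> = krein_adjoint \<Gamma>"
    using assms by (auto simp: essentially_unitary_boundary_pair_def boundary_domain_dense_def krein_essentially_unitary_def)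
  have "{p. fst p \<in> rel_adjoint A} = rel_adjoint A \<times> (UNIV::('b\<times>'b) set)" by auto
  then have "closed {p::('a\<times>'a)\<times>('b\<times>'b). fst p \<in> rel_adjoint A}"
    by (simp add: closed_Times closed_rel_adjoint)
  then have "closure \<Gamma> \<subseteq> {p. fst p \<in> rel_adjoint A}" using a(1) by (intro closure_minimal) auto
  moreover have "Domain \<Gamma> \<subseteq> Domain (closure \<Gamma>)" using closure_subset[of \<Gamma>] by blast
  ultimately show ?thesis using a closure_mono[OF \<open>Domain \<Gamma> \<subseteq> Domain (closure \<Gamma>)\<close>]
    by (force simp: unitary_boundary_pair_def boundary_domain_dense_def krein_unitary_def krein_adjoint_closure linear_relation_closure)
qed


section \<open>Nevanlinna families\<close>

definition dissipative :: "('a::complex_hilbert \<times> 'a) set \<Rightarrow> bool" where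
  "dissipative M \<longleftrightarrow> linear_relation M \<and> (\<forall>(h, h') \<in> M. Im (cinner h h') \<ge> 0)"

definition accumulative :: "('a::complex_hilbert \<times> 'a) set \<Rightarrow> bool" where
  "accumulative M \<longleftrightarrow> linear_relation M \<and> (\<forall>(h, h') \<in> M. Im (cinner h h') \<le> 0)"

definition maximal_dissipative :: "('a::complex_hilbert \<times> 'a) set \<Rightarrow> bool" where
  "maximal_dissipative M \<longleftrightarrow> dissipative M \<and> (\<forall>N. dissipative N \<and> M \<subseteq> N \<longrightarrow> N = M)"

definition maximal_accumulative :: "('a::complex_hilbert \<times> 'a) set \<Rightarrow> bool" where
  "maximal_accumulative M \<longleftrightarrow> accumulative M \<and> (\<forall>N. accumulative N \<and> M \<subseteq> N \<longrightarrow> N = M)"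

text \<open>Analyticity on an open set \<open>S\<close> is complex differentiability with respect to the operator norm.\<close>

definition operator_analytic_on ::
    "(complex \<Rightarrow> ('a::complex_hilbert \<times> 'a) set) \<Rightarrow> complex set \<Rightarrow> bool" where
  "operator_analytic_on R S \<longleftrightarrow>
     (\<exists>F. (\<forall>z\<in>S. bounded_clinear (F z) \<and> R z = graph_of (F z)) \<and>
          (\<forall>z\<in>S. \<exists>D. bounded_clinear D \<and>
             ((\<lambda>u. onorm (\<lambda>x. inverse (u - z) *\<^sub>C (F u x - F z x) - D x)) \<longlongrightarrow> 0) (at z)))"

definition nevanlinna_families :: "(complex \<Rightarrow> ('a::complex_hilbert \<times> 'a) set) set" where
  "nevanlinna_families =
     {M. (\<forall>z. Im z > 0 \<longrightarrow> maximal_dissipative (M z)) \<and>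
         (\<forall>z. Im z < 0 \<longrightarrow> maximal_accumulative (M z)) \<and>
         (\<forall>w. Im w > 0 \<longrightarrow> operator_analytic_on (\<lambda>z. (rel_add_scalar (M z) w)\<inverse>) {z. Im z > 0}) \<and>
         (\<forall>w. Im w < 0 \<longrightarrow> operator_analytic_on (\<lambda>z. (rel_add_scalar (M z) w)\<inverse>) {z. Im z < 0}) \<and>
         (\<forall>z. z \<notin> \<real> \<longrightarrow> rel_adjoint (M z) = M (cnj z))}"

text \<open>The class \<open>\<R>[\<H>]\<close>.\<close>

definition nevanlinna_functions :: "(complex \<Rightarrow> ('a::complex_hilbert \<times> 'a) set) set" where
  "nevanlinna_functions =
     {M \<in> nevanlinna_families. \<forall>z. z \<notin> \<real> \<longrightarrow> single_valued (M z) \<and> Domain (M z) = UNIV}"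

end

theory Submission
  imports Defs
begin

text \<open>
  Let \<open>F z\<close> be the everywhere defined bounded operator whose graph is \<open>M\<^sub>\<Gamma>(z)\<close>. For every \<open>h\<close> there is a
  vector \<open>G z h\<close> such that \<open>\<Gamma>\<close> relates \<open>(G z h, z G z h)\<close> to \<open>(h, F z h)\<close>; this is the
  \<open>\<gamma>\<close>-field. Since \<open>\<Gamma>\<close> is isometric for the two Krein space products, Green's identity
  \<open>(w - cnj z) \<langle>G z h, G w k\<rangle> = \<langle>h, F w k\<rangle> - \<langle>F z h, k\<rangle>\<close> holds for all nonreal \<open>z\<close>, \<open>w\<close>
  (\<open>krein_isometric_green\<close>), and the three parts of the proof exploit it for different \<open>z\<close> and \<open>w\<close>.

  \<^emph>\<open>Equality of the Weyl families.\<close> The closure of \<open>\<Gamma>\<close> is isometric too. Apply Green's identity for it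
  to an arbitrary element \<open>(h, h')\<close> of the larger family at \<open>z\<close> and to \<open>(k, F (cnj z) k)\<close> at \<open>cnj z\<close>.
  The factor on the left vanishes, so \<open>\<langle>k, h'\<rangle> = \<langle>F (cnj z) k, h\<rangle> = \<langle>k, F z h\<rangle>\<close> for all \<open>k\<close>, and
  \<open>h' = F z h\<close>. Hence an everywhere defined Weyl family cannot grow under closure.

  \<^emph>\<open>Half planes, adjoints, maximality.\<close> With \<open>w = z\<close>, Green's identity reads
  \<open>Im \<langle>h, F z h\<rangle> = Im z \<parallel>G z h\<parallel>\<^sup>2\<close>; with \<open>w = cnj z\<close> it says \<open>F(z)\<^sup>* = F(cnj z)\<close>. A dissipative or
  accumulative operator defined everywhere is maximal, because a multivalued part of an extension
  would push the form out of the half plane (\<open>everywhere_defined_half_plane_maximal\<close>).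

  \<^emph>\<open>Analyticity.\<close> The two identities combine to
  \<open>\<langle>h, (F w - F v) k\<rangle> = (w - v) \<langle>G (cnj v) h, G w k\<rangle>\<close>, so that the difference quotient of \<open>F\<close> at \<open>v\<close>
  is \<open>G(cnj v)\<^sup>* G(w)\<close>, and \<open>F\<close> is differentiable in norm at \<open>v\<close> as soon as \<open>G\<close> is norm continuous
  there. That continuity comes again from Green's identity: it bounds \<open>G\<close> locally
  (\<open>gamma_locally_bounded\<close>), then expresses \<open>\<parallel>G w k - G z k\<parallel>\<^sup>2\<close> through quantities of order
  \<open>\<bar>w - z\<bar>\<close> (\<open>gamma_continuous\<close>). Finally \<open>F z + w\<close> is coercive up to a unimodular factor when \<open>z\<close> and \<open>w\<close>
  lie in the same half plane, so it has a bounded inverse (\<open>coercive_inverse\<close>), and inversion preserves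
  differentiability in norm (\<open>operator_has_derivative_inverse\<close>).
\<close>

section \<open>Complements on complex Hilbert spaces\<close>

lemma norm_cinner_le:
  fixes x y :: "'a::complex_hilbert"
  shows "cmod (cinner x y) \<le> norm x * norm y"
proof (cases "cinner x y = 0")
  case False
  define c where "c = cnj (cinner x y) / complex_of_real (cmod (cinner x y))"
  have "cinner x (c *\<^sub>C y) = complex_of_real (cmod (cinner x y))"
    using False complex_norm_square[of "cinner x y"]
    by (simp add: cinner_scaleC_right c_def field_simps power2_eq_square)
  moreover have "cmod c = 1" using False by (simp add: c_def norm_divide)
  ultimately show ?thesis using Re_cinner_le_norm[of x "c *\<^sub>C y"] by (simp add: norm_scaleC)
qed simp

lemma norm_diff_power2:
  fixes x y :: "'a::complex_hilbert"
  shows "(norm (x - y))\<^sup>2 = (norm x)\<^sup>2 - 2 * Re (cinner x y) + (norm y)\<^sup>2"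
proof -
  have "cinner (x - y) (x - y) = cinner x x - cinner x y - cinner y x + cinner y y"
    by (simp add: cinner.diff_left cinner.diff_right)
  from arg_cong[OF this, of Re] arg_cong[OF cinner_commute[of y x], of Re]
  show ?thesis by (simp add: cinner_self)
qed

lemma norm_le_of_cinner_le:
  fixes x :: "'a::complex_hilbert"
  assumes "\<And>h. cmod (cinner h x) \<le> c * norm h" "0 \<le> c"
  shows "norm x \<le> c"
proof (cases "x = 0")
  case False
  have "norm x * norm x \<le> c * norm x"
    using assms(1)[of x] by (simp add: cinner_self norm_power power2_eq_square norm_mult)
  then show ?thesis using False by simp
qed (use assms in simp)

lemma cinner_eqI:
  fixes x y :: "'a::complex_hilbert"
  assumes "\<And>h. cinner h x = cinner h y"
  shows "x = y"
  using norm_le_of_cinner_le[of "x - y" 0] assms by (simp add: cinner.diff_right)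

lemma scaleC_diff_right:
  fixes x y :: "'a::complex_vector"
  shows "c *\<^sub>C (x - y) = c *\<^sub>C x - c *\<^sub>C y"
  by (rule complex_vector.scale_right_diff_distrib)

lemma bounded_clinear_linear: "bounded_clinear F \<Longrightarrow> bounded_linear F"
  by (simp add: bounded_clinear_def)

lemma bounded_clinear_scaleC: "bounded_clinear F \<Longrightarrow> F (c *\<^sub>C x) = c *\<^sub>C F x"
  by (simp add: bounded_clinear_def)

lemma bounded_clinear_compose:
  "bounded_clinear f \<Longrightarrow> bounded_clinear g \<Longrightarrow> bounded_clinear (\<lambda>x. f (g x))"
  by (simp add: bounded_clinear_def bounded_linear_compose)

lemma bounded_clinear_mult_scaleC: "bounded_clinear f \<Longrightarrow> bounded_clinear (\<lambda>x. c *\<^sub>C f x)"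
  using bounded_linear_compose[OF bounded_linear_scaleC[of c]]
  by (auto simp: bounded_clinear_def scaleC_scaleC mult.commute)

lemma bounded_clinear_add_scalar: "bounded_clinear F \<Longrightarrow> bounded_clinear (\<lambda>x. F x + w *\<^sub>C x)"
  using bounded_linear_add[OF _ bounded_linear_scaleC[of w]]
  by (auto simp: bounded_clinear_def scaleC_scaleC scaleC_add_right mult.commute)

lemma bounded_clinearI:
  fixes F :: "'a::complex_hilbert \<Rightarrow> 'b::complex_hilbert"
  assumes "\<And>x y. F (x + y) = F x + F y" "\<And>c x. F (c *\<^sub>C x) = c *\<^sub>C F x"
    "\<And>x. norm (F x) \<le> K * norm x"
  shows "bounded_clinear F"
  unfolding bounded_clinear_def
  using assms by (auto intro!: bounded_linear_intro[of F K] simp: scaleR_scaleC mult.commute)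

section \<open>Coercive operators\<close>

text \<open>The linear case of Zarantonello's theorem: for small \<open>t > 0\<close> the map
  \<open>h \<mapsto> h - t (B h - y)\<close> is a strict contraction, because coercivity makes the linear term in
  \<open>\<parallel>h - t B h\<parallel>\<^sup>2\<close> negative and boundedness controls the quadratic one. Its fixed point is the
  solution.\<close>

lemma coercive_solution:
  fixes B :: "'a::complex_hilbert \<Rightarrow> 'a"
  assumes B: "bounded_linear B" and m: "m > 0"
    and coercive: "\<And>h. m * (norm h)\<^sup>2 \<le> Re (cinner h (B h))"
  shows "\<exists>!h. B h = y"
proof -
  obtain K where K: "K > 0" "\<And>x. norm (B x) \<le> norm x * K"
    using bounded_linear.pos_bounded[OF B] by blast
  \<comment> \<open>With \<open>t = m / K\<^sup>2\<close> the squared contraction factor would be \<open>1 - m\<^sup>2 / K\<^sup>2\<close>; the larger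
    denominator \<open>L\<close> keeps it nonnegative without having to compare \<open>m\<close> and \<open>K\<close>.\<close>
  define L where "L = K\<^sup>2 + m\<^sup>2"
  define t where "t = m / L"
  define q where "q = 1 - m\<^sup>2 / L"
  have L: "L > 0" "K\<^sup>2 \<le> L" "m\<^sup>2 \<le> L" "m\<^sup>2 > 0" using m K by (auto simp: L_def add_pos_pos)
  have t: "t > 0" unfolding t_def using m L(1) by (rule divide_pos_pos)
  have "0 < m\<^sup>2 / L" "m\<^sup>2 / L \<le> 1"
    using divide_pos_pos[OF L(4,1)] divide_right_mono[OF L(3), of L] L(1) by auto
  then have q: "0 \<le> q" "q < 1" by (auto simp: q_def)
  have contr: "norm (h - t *\<^sub>R B h) \<le> sqrt q * norm h" for h
  proof -
    have "(norm (h - t *\<^sub>R B h))\<^sup>2 = (norm h)\<^sup>2 - 2 * t * Re (cinner h (B h)) + t\<^sup>2 * (norm (B h))\<^sup>2"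
      unfolding norm_diff_power2 by (simp add: cinner_scaleR_right power_mult_distrib)
    also have "\<dots> \<le> (norm h)\<^sup>2 - 2 * t * (m * (norm h)\<^sup>2) + t\<^sup>2 * (norm h * K)\<^sup>2"
      using coercive[of h] t K(2)[of h]
      by (intro add_mono diff_mono mult_left_mono power_mono) auto
    also have "\<dots> \<le> (norm h)\<^sup>2 - 2 * t * (m * (norm h)\<^sup>2) + t\<^sup>2 * ((norm h)\<^sup>2 * L)"
      using L by (intro add_left_mono mult_left_mono) (auto simp: power_mult_distrib mult_left_mono)
    also have "\<dots> = q * (norm h)\<^sup>2"
      using L(1) by (simp add: t_def q_def field_simps power2_eq_square)
    also have "\<dots> = (sqrt q * norm h)\<^sup>2"
      using q by (simp add: power_mult_distrib)
    finally show ?thesis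
      using q by (simp add: power2_le_iff_abs_le)
  qed
  interpret B: bounded_linear B by (rule B)
  have "\<exists>!h. h - t *\<^sub>R (B h - y) = h"
  proof (rule banach_fix_type[of "sqrt q"])
    show "\<forall>x z. dist (x - t *\<^sub>R (B x - y)) (z - t *\<^sub>R (B z - y)) \<le> sqrt q * dist x z"
    proof (intro allI)
      fix x z
      have "x - t *\<^sub>R (B x - y) - (z - t *\<^sub>R (B z - y)) = (x - z) - t *\<^sub>R B (x - z)"
        by (simp add: B.diff algebra_simps)
      then show "dist (x - t *\<^sub>R (B x - y)) (z - t *\<^sub>R (B z - y)) \<le> sqrt q * dist x z"
        using contr[of "x - z"] by (simp only: dist_norm)
    qed
  qed (use q in auto)
  then show ?thesis using t by simp
qed

text \<open>The hypothesis says that the numerical range of \<open>T\<close> lies in a half plane whose distance from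
  the origin is at least \<open>m\<close>. The unimodular factor \<open>a\<close> rotates this half plane to the right one, so that the upper
  and the lower half plane are treated together.\<close>

lemma coercive_inverse:
  fixes T :: "'a::complex_hilbert \<Rightarrow> 'a"
  assumes T: "bounded_clinear T" and m: "m > 0" and a: "cmod a = 1"
    and coercive: "\<And>h. m * (norm h)\<^sup>2 \<le> Re (a * cinner h (T h))"
  obtains R where "bounded_clinear R" "\<And>x. T (R x) = x" "\<And>x. R (T x) = x"
    "\<And>x. norm (R x) \<le> norm x / m"
proof -
  have a0: "a \<noteq> 0" using a by auto
  have B: "bounded_linear (\<lambda>h. a *\<^sub>C T h)"
    by (rule bounded_clinear_linear[OF bounded_clinear_mult_scaleC[OF T]])
  have ex: "\<exists>!h. T h = y" for y
  proof -
    have "a *\<^sub>C T h = a *\<^sub>C y \<longleftrightarrow> T h = y" for h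
      using a0 by simp
    then show ?thesis
      using coercive_solution[OF B m, of "a *\<^sub>C y"] coercive by (simp add: cinner_scaleC_right)
  qed
  define R where "R = (\<lambda>y. THE h. T h = y)"
  have TR: "T (R x) = x" for x unfolding R_def by (rule theI'[OF ex])
  have RI: "T h = y \<Longrightarrow> R y = h" for h y using ex TR by blast
  have bound: "norm (R x) \<le> norm x / m" for x
  proof (cases "R x = 0")
    case False
    have "m * (norm (R x))\<^sup>2 \<le> cmod (a * cinner (R x) x)"
      using coercive[of "R x"] complex_Re_le_cmod[of "a * cinner (R x) x"] TR by simp
    also have "\<dots> \<le> norm (R x) * norm x" using a norm_cinner_le by (simp add: norm_mult)
    finally show ?thesis using False m by (simp add: power2_eq_square field_simps)
  qed (use m in simp)
  interpret T: bounded_linear T by (rule bounded_clinear_linear[OF T])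
  have "bounded_clinear R"
    by (rule bounded_clinearI[of R "1/m"])
       (use bound in \<open>auto intro!: RI simp: T.add TR bounded_clinear_scaleC[OF T]\<close>)
  then show ?thesis using that TR RI bound by blast
qed

section \<open>Maximality\<close>

lemma linear_relation_graph_of:
  assumes "bounded_clinear F"
  shows "linear_relation (graph_of F)"
proof -
  interpret bounded_linear F by (rule bounded_clinear_linear[OF assms])
  show ?thesis
    by (rule complex_vector.subspaceI)
      (auto simp: graph_of_def zero_prod_def zero add scaleC_prod_def bounded_clinear_scaleC[OF assms])
qed

text \<open>Taking \<open>s\<close> positive or negative gives the dissipative and the accumulative case. If \<open>N\<close>
  contained \<open>(h, h')\<close> off the graph, then \<open>k = h' - F h\<close> would be a nonzero element of its
  multivalued part, and adding multiples of \<open>- \<i> k\<close> to \<open>F k\<close> would move \<open>Im \<langle>k, \<cdot>\<rangle>\<close> through all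
  of the real line.\<close>

lemma everywhere_defined_half_plane_maximal:
  fixes F :: "'a::complex_hilbert \<Rightarrow> 'a" and s :: real
  assumes N: "linear_relation N" and sub: "graph_of F \<subseteq> N" and s: "s \<noteq> 0"
    and half: "\<And>h h'. (h, h') \<in> N \<Longrightarrow> 0 \<le> s * Im (cinner h h')"
  shows "N = graph_of F"
proof
  show "N \<subseteq> graph_of F"
  proof clarify
    fix h h' assume h: "(h, h') \<in> N"
    define k where "k = h' - F h"
    have F: "(x, F x) \<in> N" for x using sub by (auto simp: graph_of_def)
    have k: "(0, k) \<in> N" using complex_vector.subspace_diff[OF N h F[of h]] by (simp add: k_def)
    have ineq: "0 \<le> s * Im (cinner k (F k)) - t * (s\<^sup>2 * (norm k)\<^sup>2)" for t
    proof -
      have "(k, F k + (- \<i> * of_real (s * t)) *\<^sub>C k) \<in> N"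
        using complex_vector.subspace_add[OF N F[of k]
            complex_vector.subspace_scale[OF N k, of "- \<i> * of_real (s * t)"]]
        by (simp add: scaleC_prod_def)
      from half[OF this] show ?thesis
        by (simp add: cinner_add_right cinner_scaleC_right cinner_self algebra_simps power2_eq_square
              del: complex_vector.scale_minus_left)
    qed
    have "k = 0"
    proof (rule ccontr)
      assume "k \<noteq> 0"
      then have "s\<^sup>2 * (norm k)\<^sup>2 \<noteq> 0" using s by simp
      then show False
        using ineq[of "(s * Im (cinner k (F k)) + 1) / (s\<^sup>2 * (norm k)\<^sup>2)"] by simp
    qed
    then show "(h, h') \<in> graph_of F" by (simp add: k_def graph_of_def)
  qed
qed (rule sub)


section \<open>Analyticity of the resolvents\<close>

text \<open>The pointwise condition in \<^const>\<open>operator_analytic_on\<close>, with the derivative named.\<close>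

definition operator_has_derivative ::
    "(complex \<Rightarrow> 'a::complex_hilbert \<Rightarrow> 'a) \<Rightarrow> ('a \<Rightarrow> 'a) \<Rightarrow> complex \<Rightarrow> bool" where
  "operator_has_derivative F D z \<longleftrightarrow> bounded_clinear D \<and>
     ((\<lambda>u. onorm (\<lambda>x. inverse (u - z) *\<^sub>C (F u x - F z x) - D x)) \<longlongrightarrow> 0) (at z)"

text \<open>Reduces convergence of the difference quotients in \<^const>\<open>onorm\<close> to a uniform vector
  estimate.\<close>

lemma operator_has_derivativeI:
  assumes D: "bounded_clinear D"
    and e: "(e \<longlongrightarrow> 0) (at z)"
    and le: "\<forall>\<^sub>F u in at z. 0 \<le> e u \<and>
      (\<forall>x. norm (inverse (u - z) *\<^sub>C (F u x - F z x) - D x) \<le> e u * norm x)"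
    and lin: "\<forall>\<^sub>F u in at z. bounded_clinear (F u)" "bounded_clinear (F z)"
  shows "operator_has_derivative F D z"
  unfolding operator_has_derivative_def
proof (intro conjI D tendsto_0_le[OF e, of _ 1])
  show "\<forall>\<^sub>F u in at z. norm (onorm (\<lambda>x. inverse (u - z) *\<^sub>C (F u x - F z x) - D x)) \<le> norm (e u) * 1"
    using le lin(1)
  proof eventually_elim
    case (elim u)
    have "bounded_linear (\<lambda>x. inverse (u - z) *\<^sub>C (F u x - F z x) - D x)"
      using elim(2) lin(2) D
      by (intro bounded_linear_sub bounded_linear_compose[OF bounded_linear_scaleC] bounded_clinear_linear)
    then show ?case
      using elim(1) onorm_pos_le[of "\<lambda>x. inverse (u - z) *\<^sub>C (F u x - F z x) - D x"]
        onorm_bound[of "e u" "\<lambda>x. inverse (u - z) *\<^sub>C (F u x - F z x) - D x"]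
      by (auto simp: mult.commute)
  qed
qed

text \<open>The usual formula \<open>(F\<inverse>)' = - F\<inverse> F' F\<inverse>\<close>. Writing \<open>Q u\<close> for the difference quotient of \<open>F\<close>, the
  resolvent identity is \<open>R u - R z = - (u - z) R u (Q u) R z\<close>. Using it twice, the error of the
  difference quotient of \<open>R\<close> is
  \<open>(u - z) R u (Q u) R z D R z - R u (Q u - D) R z\<close>, and the uniform bound \<open>1 / c\<close> on \<open>R\<close> gives the
  estimate \<open>e u\<close> in the proof.\<close>

lemma operator_has_derivative_inverse:
  fixes F R :: "complex \<Rightarrow> 'a::complex_hilbert \<Rightarrow> 'a"
  assumes F: "operator_has_derivative F D z" and S: "open S" "z \<in> S" and c: "c > 0"
    and linF: "\<And>u. u \<in> S \<Longrightarrow> bounded_clinear (F u)"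
    and linR: "\<And>u. u \<in> S \<Longrightarrow> bounded_clinear (R u)"
    and right: "\<And>u x. u \<in> S \<Longrightarrow> F u (R u x) = x" and left: "\<And>u x. u \<in> S \<Longrightarrow> R u (F u x) = x"
    and bound: "\<And>u x. u \<in> S \<Longrightarrow> norm (R u x) \<le> norm x / c"
  shows "operator_has_derivative R (\<lambda>x. (-1) *\<^sub>C R z (D (R z x))) z"
proof -
  have D: "bounded_clinear D" using F by (simp add: operator_has_derivative_def)
  define Q where "Q u x = inverse (u - z) *\<^sub>C (F u x - F z x)" for u x
  define \<delta> where "\<delta> u = onorm (\<lambda>x. Q u x - D x)" for u
  define d where "d = onorm D"
  define e where "e u = \<delta> u / c\<^sup>2 + cmod (u - z) * (\<delta> u + d) * d / c ^ 3" for u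
  have S': "\<forall>\<^sub>F u in at z. u \<in> S \<and> u \<noteq> z"
    using eventually_at_in_open[OF S] by (simp add: eventually_mono)
  have \<delta>: "(\<delta> \<longlongrightarrow> 0) (at z)"
    using F by (simp add: operator_has_derivative_def \<delta>_def[abs_def] Q_def)
  show ?thesis
  proof (rule operator_has_derivativeI)
    show "bounded_clinear (\<lambda>x. (-1) *\<^sub>C R z (D (R z x)))"
      by (rule bounded_clinear_mult_scaleC[OF bounded_clinear_compose[OF linR[OF S(2)]
            bounded_clinear_compose[OF D linR[OF S(2)]]]])
    have "(e \<longlongrightarrow> 0 / c\<^sup>2 + cmod (z - z) * (0 + d) * d / c ^ 3) (at z)"
      unfolding e_def[abs_def] using c by (intro tendsto_intros \<delta>) auto
    then show "(e \<longlongrightarrow> 0) (at z)" by simp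
    show "\<forall>\<^sub>F u in at z. 0 \<le> e u \<and>
      (\<forall>x. norm (inverse (u - z) *\<^sub>C (R u x - R z x) - (-1) *\<^sub>C R z (D (R z x))) \<le> e u * norm x)"
      using S'
    proof eventually_elim
      case (elim u)
      then have u: "u \<in> S" "u - z \<noteq> 0" by auto
      have "bounded_linear (\<lambda>x. Q u x - D x)"
        unfolding Q_def using linF u S D
        by (intro bounded_linear_sub bounded_linear_compose[OF bounded_linear_scaleC] bounded_clinear_linear)
      then have QD: "norm (Q u x - D x) \<le> \<delta> u * norm x" and \<delta>0: "0 \<le> \<delta> u" for x
        unfolding \<delta>_def by (auto intro: onorm onorm_pos_le)
      have Dd: "norm (D x) \<le> d * norm x" and d0: "0 \<le> d" for x
        unfolding d_def using bounded_clinear_linear[OF D] by (auto intro: onorm onorm_pos_le)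
      have Qd: "norm (Q u x) \<le> (\<delta> u + d) * norm x" for x
        using norm_triangle_ineq[of "Q u x - D x" "D x"] QD[of x] Dd[of x] by (simp add: algebra_simps)
      interpret R: bounded_linear "R u" by (rule bounded_clinear_linear[OF linR[OF u(1)]])
      have diff: "R u x - R z x = - ((u - z) *\<^sub>C R u (Q u (R z x)))" for x
      proof -
        have "(u - z) *\<^sub>C R u (Q u (R z x)) = R u (F u (R z x) - F z (R z x))"
          using u by (simp add: Q_def flip: bounded_clinear_scaleC[OF linR])
        then show ?thesis
          using u S by (simp add: R.diff left right)
      qed
      have "0 \<le> e u" using c \<delta>0 d0 by (auto simp: e_def)
      moreover have "norm (inverse (u - z) *\<^sub>C (R u x - R z x) - (-1) *\<^sub>C R z (D (R z x))) \<le> e u * norm x" for x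
      proof -
        let ?y = "R z x" and ?v = "D (R z x)"
        have y: "norm ?y \<le> norm x / c" by (rule bound[OF S(2)])
        have v: "norm ?v \<le> d * (norm x / c)"
          using Dd[of ?y] mult_left_mono[OF y d0] by linarith
        have "inverse (u - z) *\<^sub>C (R u x - R z x) - (-1) *\<^sub>C R z ?v = - R u (Q u ?y) + R z ?v"
          unfolding diff using u by (simp add: scaleC_one)
        also have "\<dots> = (u - z) *\<^sub>C R u (Q u (R z ?v)) - R u (Q u ?y - D ?y)"
          using diff[of ?v] by (simp add: R.diff algebra_simps)
        finally have eq: "inverse (u - z) *\<^sub>C (R u x - R z x) - (-1) *\<^sub>C R z ?v
          = (u - z) *\<^sub>C R u (Q u (R z ?v)) - R u (Q u ?y - D ?y)" .
        have "norm (R u (Q u ?y - D ?y)) \<le> (\<delta> u * (norm x / c)) / c"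
          using bound[OF u(1), of "Q u ?y - D ?y"] QD[of ?y] mult_left_mono[OF y \<delta>0] c
          by (smt (verit) divide_right_mono)
        moreover have "norm ((u - z) *\<^sub>C R u (Q u (R z ?v))) \<le>
          cmod (u - z) * (((\<delta> u + d) * (d * (norm x / c) / c)) / c)"
        proof -
          have "norm (R z ?v) \<le> d * (norm x / c) / c"
            using bound[OF S(2), of ?v] divide_right_mono[OF v, of c] c by linarith
          then have "norm (Q u (R z ?v)) \<le> (\<delta> u + d) * (d * (norm x / c) / c)"
            using Qd[of "R z ?v"] \<delta>0 d0 by (smt (verit) mult_left_mono)
          then have "norm (R u (Q u (R z ?v))) \<le> ((\<delta> u + d) * (d * (norm x / c) / c)) / c"
            using bound[OF u(1), of "Q u (R z ?v)"] c by (smt (verit) divide_right_mono)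
          then show ?thesis unfolding norm_scaleC by (rule mult_left_mono) simp
        qed
        moreover have "cmod (u - z) * (((\<delta> u + d) * (d * (norm x / c) / c)) / c) + (\<delta> u * (norm x / c)) / c = e u * norm x"
          using c by (simp add: e_def field_simps power2_eq_square power3_eq_cube)
        ultimately show ?thesis
          unfolding eq by (smt (verit) norm_triangle_ineq4)
      qed
      ultimately show ?case by blast
    qed
    show "\<forall>\<^sub>F u in at z. bounded_clinear (R u)" using S' by eventually_elim (simp add: linR)
    show "bounded_clinear (R z)" by (rule linR[OF S(2)])
  qed
qed

section \<open>Operator families satisfying Green's identity\<close>

text \<open>\<open>F\<close> stands for the Weyl function and \<open>G\<close> for the \<open>\<gamma>\<close>-field. Green's identity determines every
  inner product of values of \<open>G\<close> off the diagonal \<open>w = cnj z\<close>, so all regularity of \<open>G\<close> is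
  derived from it.\<close>

locale green_family =
  fixes F :: "complex \<Rightarrow> 'b::complex_hilbert \<Rightarrow> 'b" and G :: "complex \<Rightarrow> 'b \<Rightarrow> 'a::complex_hilbert"
  assumes bounded_clinear_F: "z \<notin> \<real> \<Longrightarrow> bounded_clinear (F z)"
    and green: "z \<notin> \<real> \<Longrightarrow> w \<notin> \<real> \<Longrightarrow>
      (w - cnj z) * cinner (G z h) (G w k) = cinner h (F w k) - cinner (F z h) k"
begin

lemma cinner_cnj_argument: "z \<notin> \<real> \<Longrightarrow> cinner h (F (cnj z) k) = cinner (F z h) k"
  using green[of z "cnj z" h k] by (simp add: Reals_cnj_iff)

text \<open>The key identity: difference quotients of \<open>F\<close> factor through \<open>G\<close>. It is Green's identity
  at \<open>cnj v\<close>, with \<open>F (cnj v)\<close> moved to the other side of the product.\<close>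

lemma green_difference:
  assumes "v \<notin> \<real>" "w \<notin> \<real>"
  shows "cinner h (F w k - F v k) = (w - v) * cinner (G (cnj v) h) (G w k)"
  using green[of "cnj v" w h k] cinner_cnj_argument[of "cnj v" h k] assms
  by (simp add: Reals_cnj_iff cinner.diff_right)

lemma imaginary_part: "z \<notin> \<real> \<Longrightarrow> Im (cinner h (F z h)) = Im z * (norm (G z h))\<^sup>2"
proof -
  assume z: "z \<notin> \<real>"
  have "cinner (F z h) h = cnj (cinner h (F z h))" by (rule cinner_commute)
  then have "2 * Im (cinner h (F z h)) = 2 * (Im z * (norm (G z h))\<^sup>2)"
    using arg_cong[OF green[OF z z, of h h], of Im] by (simp add: cinner_self)
  then show ?thesis by simp
qed

lemma gamma_bounded:
  assumes z: "z \<notin> \<real>"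
  obtains g where "g \<ge> 0" "\<And>h. norm (G z h) \<le> g * norm h"
proof -
  have im: "\<bar>Im z\<bar> > 0" using z by (simp add: complex_is_Real_iff)
  obtain K where K: "K > 0" "\<And>x. norm (F z x) \<le> norm x * K"
    using bounded_linear.pos_bounded[OF bounded_clinear_linear[OF bounded_clinear_F[OF z]]] by blast
  have "norm (G z h) \<le> sqrt (K / \<bar>Im z\<bar>) * norm h" for h
  proof -
    have "\<bar>Im z\<bar> * (norm (G z h))\<^sup>2 = \<bar>Im (cinner h (F z h))\<bar>"
      by (simp add: imaginary_part[OF z] abs_mult)
    also have "\<dots> \<le> norm h * norm (F z h)"
      using abs_Im_le_cmod[of "cinner h (F z h)"] norm_cinner_le[of h "F z h"] by linarith
    also have "\<dots> \<le> norm h * (norm h * K)" by (intro mult_left_mono K) simp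
    finally have "(norm (G z h))\<^sup>2 \<le> (sqrt (K / \<bar>Im z\<bar>) * norm h)\<^sup>2"
      using im K(1) by (simp add: power_mult_distrib field_simps power2_eq_square)
    then show ?thesis by (rule power2_le_imp_le) (use K in auto)
  qed
  then show ?thesis using that[of "sqrt (K / \<bar>Im z\<bar>)"] K(1) by auto
qed

lemma difference_bounded:
  assumes "v \<notin> \<real>" "w \<notin> \<real>" "g \<ge> 0" "\<And>h. norm (G (cnj v) h) \<le> g * norm h"
  shows "norm (F w k - F v k) \<le> cmod (w - v) * g * norm (G w k)"
proof (rule norm_le_of_cinner_le)
  fix h
  have "cmod (cinner h (F w k - F v k)) \<le> cmod (w - v) * (norm (G (cnj v) h) * norm (G w k))"
    unfolding green_difference[OF assms(1,2)] norm_mult by (intro mult_left_mono norm_cinner_le) simp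
  also have "\<dots> \<le> cmod (w - v) * ((g * norm h) * norm (G w k))"
    by (intro mult_left_mono mult_right_mono assms(4)) auto
  finally show "cmod (cinner h (F w k - F v k)) \<le> cmod (w - v) * g * norm (G w k) * norm h"
    by (simp add: mult_ac)
qed (use assms(3) in simp)

text \<open>Neighbours of \<open>z\<close> within half its distance to the real axis lie in the same half plane. There
  the factor \<open>v - cnj w\<close> of Green's identity stays away from zero.\<close>

lemma nonreal_near:
  assumes "cmod (w - z) \<le> \<bar>Im z\<bar> / 2" "z \<notin> \<real>"
  shows "w \<notin> \<real>" "\<bar>Im z\<bar> / 2 \<le> \<bar>Im w\<bar>" "\<bar>Im z\<bar> \<le> cmod (z - cnj w)" "\<bar>Im z\<bar> \<le> cmod (w - cnj w)"
proof -
  have a: "\<bar>Im w - Im z\<bar> \<le> \<bar>Im z\<bar> / 2" "Im z \<noteq> 0"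
    using abs_Im_le_cmod[of "w - z"] assms by (auto simp: complex_is_Real_iff)
  then show "w \<notin> \<real>" "\<bar>Im z\<bar> / 2 \<le> \<bar>Im w\<bar>" by (auto simp: complex_is_Real_iff abs_if split: if_splits)
  have "\<bar>Im z\<bar> \<le> \<bar>Im z + Im w\<bar>" "\<bar>Im z\<bar> \<le> \<bar>2 * Im w\<bar>" using a by (auto simp: abs_if split: if_splits)
  then show "\<bar>Im z\<bar> \<le> cmod (z - cnj w)" "\<bar>Im z\<bar> \<le> cmod (w - cnj w)"
    using abs_Im_le_cmod[of "z - cnj w"] abs_Im_le_cmod[of "w - cnj w"] by auto
qed

text \<open>The square \<open>\<parallel>G w k\<parallel>\<^sup>2\<close> is controlled by \<open>\<parallel>F w k\<parallel>\<close>, which in turn differs from \<open>\<parallel>F z k\<parallel>\<close>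
  by at most a multiple of \<open>\<parallel>G w k\<parallel>\<close>. So \<open>x = \<parallel>G w k\<parallel>\<close> satisfies a quadratic inequality
  \<open>x\<^sup>2 \<le> \<alpha> \<parallel>k\<parallel>\<^sup>2 + \<beta> \<parallel>k\<parallel> x\<close>, whose solutions are bounded by a multiple of \<open>\<parallel>k\<parallel>\<close> that does not
  depend on \<open>w\<close>.\<close>

lemma gamma_locally_bounded:
  assumes z: "z \<notin> \<real>"
  obtains K where "K \<ge> 0" "\<And>w k. cmod (w - z) \<le> \<bar>Im z\<bar> / 2 \<Longrightarrow> norm (G w k) \<le> K * norm k"
proof -
  define m where "m = \<bar>Im z\<bar> / 2"
  have m: "m > 0" using z by (simp add: m_def complex_is_Real_iff)
  obtain a where a: "a > 0" "\<And>x. norm (F z x) \<le> norm x * a"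
    using bounded_linear.pos_bounded[OF bounded_clinear_linear[OF bounded_clinear_F[OF z]]] by blast
  obtain g where g: "g \<ge> 0" "\<And>h. norm (G (cnj z) h) \<le> g * norm h"
    using gamma_bounded[of "cnj z"] z by (auto simp: Reals_cnj_iff)
  have "norm (G w k) \<le> (1 + a / m + g) * norm k" if w: "cmod (w - z) \<le> \<bar>Im z\<bar> / 2" for w k
  proof -
    note nr = nonreal_near[OF w z]
    let ?x = "norm (G w k)"
    have "m * ?x\<^sup>2 \<le> \<bar>Im w\<bar> * ?x\<^sup>2" using nr(2) by (intro mult_right_mono) (auto simp: m_def)
    also have "\<dots> = \<bar>Im (cinner k (F w k))\<bar>" by (simp add: imaginary_part[OF nr(1)] abs_mult)
    also have "\<dots> \<le> norm k * norm (F w k)"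
      using abs_Im_le_cmod[of "cinner k (F w k)"] norm_cinner_le[of k "F w k"] by linarith
    also have "\<dots> \<le> norm k * (a * norm k + m * g * ?x)"
    proof (intro mult_left_mono)
      have "norm (F w k - F z k) \<le> cmod (w - z) * g * ?x" by (rule difference_bounded[OF z nr(1) g])
      also have "\<dots> \<le> m * g * ?x" using w g(1) by (intro mult_right_mono) (auto simp: m_def)
      finally show "norm (F w k) \<le> a * norm k + m * g * ?x"
        using a(2)[of k] norm_triangle_ineq[of "F w k - F z k" "F z k"] by (simp add: mult.commute)
    qed simp
    finally have x2: "?x\<^sup>2 \<le> (a / m) * norm k * norm k + g * norm k * ?x"
      using m by (simp add: field_simps)
    show ?thesis
    proof (cases "?x \<le> norm k")
      case True
      have "1 * norm k \<le> (1 + a / m + g) * norm k" using a m g by (intro mult_right_mono) auto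
      then show ?thesis using True by simp
    next
      case False
      have "(a / m) * norm k * norm k \<le> (a / m) * norm k * ?x"
        using False a m by (intro mult_left_mono) auto
      then have "?x * ?x \<le> ((a / m + g) * norm k) * ?x"
        using x2 by (simp add: power2_eq_square algebra_simps)
      then have "?x \<le> (a / m + g) * norm k" using False norm_ge_zero[of k]
        by (intro mult_right_le_imp_le[of ?x ?x]) linarith+
      moreover have "(1 + a / m + g) * norm k = norm k + (a / m + g) * norm k" by (simp add: algebra_simps)
      ultimately show ?thesis using norm_ge_zero[of k] by linarith
    qed
  qed
  then show ?thesis using that[of "1 + a / m + g"] a m g by auto
qed

text \<open>Expand \<open>\<parallel>G w k - G z k\<parallel>\<^sup>2\<close> as the difference of \<open>\<langle>G w k - G z k, G v k\<rangle>\<close> at \<open>v = w\<close> and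
  \<open>v = z\<close>. Subtracting two instances of Green's identity shows that \<open>v - cnj w\<close> times such a product
  is of order \<open>\<bar>w - z\<bar>\<close>.\<close>

lemma gamma_continuous:
  assumes z: "z \<notin> \<real>"
  obtains C where "C \<ge> 0" "\<And>w k. cmod (w - z) \<le> \<bar>Im z\<bar> / 2 \<Longrightarrow>
    norm (G w k - G z k) \<le> C * sqrt (cmod (w - z)) * norm k"
proof -
  have im: "\<bar>Im z\<bar> > 0" using z by (simp add: complex_is_Real_iff)
  obtain K where K: "K \<ge> 0" "\<And>w k. cmod (w - z) \<le> \<bar>Im z\<bar> / 2 \<Longrightarrow> norm (G w k) \<le> K * norm k"
    using gamma_locally_bounded[OF z] by blast
  obtain g where g: "g \<ge> 0" "\<And>h. norm (G (cnj z) h) \<le> g * norm h"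
    using gamma_bounded[of "cnj z"] z by (auto simp: Reals_cnj_iff)
  define B where "B = (K\<^sup>2 + g * K) / \<bar>Im z\<bar>"
  have B0: "B \<ge> 0" using K g im by (simp add: B_def)
  have "norm (G w k - G z k) \<le> sqrt (2 * B) * sqrt (cmod (w - z)) * norm k"
    if w: "cmod (w - z) \<le> \<bar>Im z\<bar> / 2" for w k
  proof -
    note nr = nonreal_near[OF w z]
    have zz: "cmod (z - z) \<le> \<bar>Im z\<bar> / 2" by simp
    have dF: "norm (F w k - F z k) \<le> cmod (w - z) * g * (K * norm k)"
      using difference_bounded[OF z nr(1) g, of k] K(2)[OF w, of k] g(1)
      by (smt (verit) mult_left_mono mult_nonneg_nonneg norm_ge_zero)
    have est: "cmod (cinner (G w k - G z k) (G v k)) \<le> cmod (w - z) * B * (norm k)\<^sup>2"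
      if v: "v = w \<or> v = z" for v
    proof -
      have vr: "v \<notin> \<real>" and vw: "\<bar>Im z\<bar> \<le> cmod (v - cnj w)" and vK: "norm (G v k) \<le> K * norm k"
        using v nr z K(2)[OF w] K(2)[OF zz] by auto
      have "(v - cnj w) * cinner (G w k - G z k) (G v k)
          = (cnj w - cnj z) * cinner (G z k) (G v k) - cinner (F w k - F z k) k"
        using arg_cong2[OF green[OF nr(1) vr, of k k] green[OF z vr, of k k], of "(-)"]
        by (simp add: cinner.diff_left algebra_simps)
      then have "cmod (v - cnj w) * cmod (cinner (G w k - G z k) (G v k))
          \<le> cmod (cnj w - cnj z) * cmod (cinner (G z k) (G v k)) + cmod (cinner (F w k - F z k) k)"
        by (metis norm_mult norm_triangle_ineq4)
      also have "\<dots> \<le> cmod (w - z) * ((K * norm k) * (K * norm k)) + (cmod (w - z) * g * (K * norm k)) * norm k"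
      proof (intro add_mono)
        have "cmod (cnj w - cnj z) = cmod (w - z)" by (metis complex_cnj_diff complex_mod_cnj)
        moreover have "cmod (cinner (G z k) (G v k)) \<le> (K * norm k) * (K * norm k)"
          using norm_cinner_le[of "G z k" "G v k"] mult_mono[OF K(2)[OF zz, of k] vK] K(1) by simp
        ultimately show "cmod (cnj w - cnj z) * cmod (cinner (G z k) (G v k)) \<le> cmod (w - z) * ((K * norm k) * (K * norm k))"
          by (simp add: mult_left_mono)
        show "cmod (cinner (F w k - F z k) k) \<le> (cmod (w - z) * g * (K * norm k)) * norm k"
          using norm_cinner_le[of "F w k - F z k" k] mult_right_mono[OF dF, of "norm k"] by simp
      qed
      also have "\<dots> = \<bar>Im z\<bar> * (cmod (w - z) * B * (norm k)\<^sup>2)"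
        using im by (simp add: B_def field_simps power2_eq_square)
      finally have "\<bar>Im z\<bar> * cmod (cinner (G w k - G z k) (G v k)) \<le> \<bar>Im z\<bar> * (cmod (w - z) * B * (norm k)\<^sup>2)"
        using mult_right_mono[OF vw, of "cmod (cinner (G w k - G z k) (G v k))"] by simp
      then show ?thesis using im by (simp add: mult_le_cancel_left)
    qed
    have "(norm (G w k - G z k))\<^sup>2 = cmod (cinner (G w k - G z k) (G w k) - cinner (G w k - G z k) (G z k))"
      by (simp add: cinner_self norm_power flip: cinner.diff_right)
    also have "\<dots> \<le> 2 * (cmod (w - z) * B * (norm k)\<^sup>2)"
      using norm_triangle_ineq4[of "cinner (G w k - G z k) (G w k)" "cinner (G w k - G z k) (G z k)"]
        est[of w] est[of z] by simp
    also have "\<dots> = (sqrt (2 * B) * sqrt (cmod (w - z)) * norm k)\<^sup>2"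
      using B0 by (simp add: power_mult_distrib)
    finally show ?thesis by (rule power2_le_imp_le) (use B0 in simp)
  qed
  then show ?thesis using that[of "sqrt (2 * B)"] B0 by auto
qed

text \<open>The derivative is \<open>G(cnj z)\<^sup>* G(z)\<close>. It is obtained as the
  pointwise limit \<open>D\<close> of the difference quotients \<open>Q\<close> along a sequence \<open>U\<close> tending to \<open>z\<close>; the limit exists
  since \<open>\<parallel>Q u k - Q v k\<parallel> \<le> g \<parallel>G u k - G v k\<parallel>\<close>. The weak formula \<open>weakD\<close> then identifies \<open>D\<close> and
  gives the uniform estimate for all \<open>u\<close> near \<open>z\<close>.\<close>

lemma norm_differentiable:
  assumes z: "z \<notin> \<real>"
  obtains D where "operator_has_derivative F D z"
proof -
  have im: "\<bar>Im z\<bar> > 0" using z by (simp add: complex_is_Real_iff)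
  obtain C where C: "C \<ge> 0" "\<And>w k. cmod (w - z) \<le> \<bar>Im z\<bar> / 2 \<Longrightarrow>
    norm (G w k - G z k) \<le> C * sqrt (cmod (w - z)) * norm k"
    using gamma_continuous[OF z] by blast
  obtain g where g: "g \<ge> 0" "\<And>h. norm (G (cnj z) h) \<le> g * norm h"
    using gamma_bounded[of "cnj z"] z by (auto simp: Reals_cnj_iff)
  obtain g' where g': "g' \<ge> 0" "\<And>h. norm (G z h) \<le> g' * norm h"
    using gamma_bounded[OF z] by blast
  define Q where "Q u k = inverse (u - z) *\<^sub>C (F u k - F z k)" for u k
  have Q: "cinner h (Q u k) = cinner (G (cnj z) h) (G u k)" if "u \<notin> \<real>" "u \<noteq> z" for u h k
    using that by (simp add: Q_def cinner_scaleC_right green_difference[OF z that(1)])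
  \<comment> \<open>Any sequence off \<open>z\<close> that stays within half the distance to the real axis would do; this one
    moves parallel to the axis.\<close>
  define U where "U n = z + of_real (\<bar>Im z\<bar> / 2 / real (Suc n))" for n
  have Uz: "cmod (U n - z) = \<bar>Im z\<bar> / 2 / real (Suc n)" for n
    by (simp add: U_def norm_divide norm_mult del: of_nat_Suc)
  have U: "cmod (U n - z) \<le> \<bar>Im z\<bar> / 2" "U n \<noteq> z" "U n \<notin> \<real>" for n
  proof -
    show "U n \<noteq> z" using im by (simp add: U_def del: of_nat_Suc)
    show le: "cmod (U n - z) \<le> \<bar>Im z\<bar> / 2"
      unfolding Uz using im by (simp add: field_simps mult_left_le)
    show "U n \<notin> \<real>" by (rule nonreal_near(1)[OF le z])
  qed
  have Ulim: "(\<lambda>n. cmod (U n - z)) \<longlonglongrightarrow> 0"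
    unfolding Uz by (rule lim_const_over_n[THEN LIMSEQ_Suc])
  have GU: "(\<lambda>n. G (U n) k) \<longlonglongrightarrow> G z k" for k
  proof (rule LIM_zero_cancel, rule tendsto_0_le)
    show "\<forall>\<^sub>F n in sequentially.
      norm (G (U n) k - G z k) \<le> norm (C * sqrt (cmod (U n - z)) * norm k) * 1"
      using C(2)[OF U(1)] by (intro always_eventually allI) (smt (verit) real_norm_def mult_1_right)
    have "(\<lambda>n. C * sqrt (cmod (U n - z)) * norm k) \<longlonglongrightarrow> C * sqrt 0 * norm k"
      by (intro tendsto_intros Ulim)
    then show "(\<lambda>n. C * sqrt (cmod (U n - z)) * norm k) \<longlonglongrightarrow> 0" by simp
  qed
  have "convergent (\<lambda>n. Q (U n) k)" for k
  proof (rule Cauchy_convergent, rule metric_CauchyI)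
    fix e :: real assume e: "e > 0"
    obtain N where N: "\<And>m n. m \<ge> N \<Longrightarrow> n \<ge> N \<Longrightarrow> dist (G (U m) k) (G (U n) k) < e / (g + 1)"
      using metric_CauchyD[OF LIMSEQ_imp_Cauchy[OF GU[of k]], of "e / (g + 1)"] e g(1) by auto
    have "dist (Q (U m) k) (Q (U n) k) < e" if "m \<ge> N" "n \<ge> N" for m n
    proof -
      have "norm (Q (U m) k - Q (U n) k) \<le> g * norm (G (U m) k - G (U n) k)"
      proof (rule norm_le_of_cinner_le)
        fix h
        have "cinner h (Q (U m) k - Q (U n) k) = cinner (G (cnj z) h) (G (U m) k - G (U n) k)"
          by (simp add: Q U cinner.diff_right)
        then show "cmod (cinner h (Q (U m) k - Q (U n) k)) \<le> g * norm (G (U m) k - G (U n) k) * norm h"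
          using norm_cinner_le[of "G (cnj z) h" "G (U m) k - G (U n) k"]
            mult_right_mono[OF g(2)[of h] norm_ge_zero[of "G (U m) k - G (U n) k"]] by (simp add: mult_ac)
      qed (use g in simp)
      also have "\<dots> \<le> (g + 1) * norm (G (U m) k - G (U n) k)" by (intro mult_right_mono) auto
      also have "\<dots> < e" using N[OF that] g(1) by (simp add: dist_norm field_simps)
      finally show ?thesis by (simp add: dist_norm)
    qed
    then show "\<exists>M. \<forall>m\<ge>M. \<forall>n\<ge>M. dist (Q (U m) k) (Q (U n) k) < e" by blast
  qed
  then obtain D where D: "\<And>k. (\<lambda>n. Q (U n) k) \<longlonglongrightarrow> D k"
    unfolding convergent_def by metis
  have weakD: "cinner h (D k) = cinner (G (cnj z) h) (G z k)" for h k
  proof (rule LIMSEQ_unique)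
    show "(\<lambda>n. cinner h (Q (U n) k)) \<longlonglongrightarrow> cinner h (D k)" by (intro cinner.tendsto tendsto_const D)
    show "(\<lambda>n. cinner h (Q (U n) k)) \<longlonglongrightarrow> cinner (G (cnj z) h) (G z k)"
      unfolding Q[OF U(3,2)] by (intro cinner.tendsto tendsto_const GU)
  qed
  have linQ: "bounded_clinear (Q (U n))" for n
  proof -
    have a: "bounded_clinear (F (U n))" "bounded_clinear (F z)" using bounded_clinear_F U z by auto
    then have "bounded_clinear (\<lambda>k. F (U n) k - F z k)"
      by (auto simp: bounded_clinear_def bounded_linear_sub scaleC_diff_right)
    then show ?thesis unfolding Q_def by (rule bounded_clinear_mult_scaleC)
  qed
  have "bounded_clinear D"
  proof (rule bounded_clinearI)
    show "D (x + y) = D x + D y" for x y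
      using D[of "x + y"] tendsto_add[OF D[of x] D[of y]]
      by (auto intro: LIMSEQ_unique simp: linear_simps[OF bounded_clinear_linear[OF linQ]])
    show "D (c *\<^sub>C x) = c *\<^sub>C D x" for c x
      using D[of "c *\<^sub>C x"] bounded_linear.tendsto[OF bounded_linear_scaleC D[of x], of c]
      by (auto intro: LIMSEQ_unique simp: bounded_clinear_scaleC[OF linQ])
    show "norm (D x) \<le> (g * g') * norm x" for x
    proof (rule norm_le_of_cinner_le)
      show "cmod (cinner h (D x)) \<le> g * g' * norm x * norm h" for h
        unfolding weakD using norm_cinner_le[of "G (cnj z) h" "G z x"] g g'
          mult_mono[OF g(2)[of h] g'(2)[of x]] by (simp add: mult_ac)
    qed (use g g' in simp)
  qed
  moreover have near: "\<forall>\<^sub>F u in at z. u \<noteq> z \<and> cmod (u - z) \<le> \<bar>Im z\<bar> / 2"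
    unfolding eventually_at using im by (intro exI[of _ "\<bar>Im z\<bar> / 2"]) (auto simp: dist_norm)
  have "operator_has_derivative F D z"
  proof (rule operator_has_derivativeI[of D "\<lambda>u. g * (C * sqrt (cmod (u - z)))"])
    have "((\<lambda>u. g * (C * sqrt (cmod (u - z)))) \<longlongrightarrow> g * (C * sqrt (cmod (z - z)))) (at z)"
      by (intro tendsto_intros)
    then show "((\<lambda>u. g * (C * sqrt (cmod (u - z)))) \<longlongrightarrow> 0) (at z)" by simp
    show "\<forall>\<^sub>F u in at z. 0 \<le> g * (C * sqrt (cmod (u - z))) \<and>
      (\<forall>k. norm (inverse (u - z) *\<^sub>C (F u k - F z k) - D k) \<le> g * (C * sqrt (cmod (u - z))) * norm k)"
      using near
    proof eventually_elim
      case (elim u)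
      then have u: "u \<noteq> z" "cmod (u - z) \<le> \<bar>Im z\<bar> / 2" by auto
      have "norm (Q u k - D k) \<le> g * (C * sqrt (cmod (u - z))) * norm k" for k
      proof (rule norm_le_of_cinner_le)
        fix h
        have "cinner h (Q u k - D k) = cinner (G (cnj z) h) (G u k - G z k)"
          using Q[OF nonreal_near(1)[OF u(2) z] u(1)] by (simp add: cinner.diff_right weakD)
        then show "cmod (cinner h (Q u k - D k)) \<le> g * (C * sqrt (cmod (u - z))) * norm k * norm h"
          using norm_cinner_le[of "G (cnj z) h" "G u k - G z k"] g(1)
            mult_mono[OF g(2)[of h] C(2)[OF u(2), of k]] by (simp add: mult_ac)
      qed (use g C in simp)
      then show ?case using g C by (simp add: Q_def)
    qed
    show "\<forall>\<^sub>F u in at z. bounded_clinear (F u)"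
      using near by eventually_elim (use bounded_clinear_F nonreal_near(1) z in blast)
  qed (use bounded_clinear_F[OF z] \<open>bounded_clinear D\<close> in auto)
  then show ?thesis by (rule that)
qed

text \<open>The condition on \<open>z\<close> puts it in the half plane of \<open>w\<close>. There \<open>Im \<langle>h, F z h\<rangle>\<close> and \<open>Im w \<parallel>h\<parallel>\<^sup>2\<close>
  have the same sign, so that \<open>F z + w\<close> is coercive after multiplication with \<open>\<plusminus> \<i>\<close>, with the
  constant \<open>\<bar>Im w\<bar>\<close> independent of \<open>z\<close>.\<close>

lemma resolvent_analytic:
  assumes w: "w \<notin> \<real>"
  shows "operator_analytic_on (\<lambda>z. (rel_add_scalar (graph_of (F z)) w)\<inverse>) {z. 0 < sgn (Im w) * Im z}"
proof -
  let ?S = "{z. 0 < sgn (Im w) * Im z}"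
  have im: "Im w \<noteq> 0" using w by (simp add: complex_is_Real_iff)
  have nr: "z \<notin> \<real>" if "z \<in> ?S" for z using that by (auto simp: complex_is_Real_iff)
  define inverts where "inverts z R \<longleftrightarrow> bounded_clinear R \<and> (\<forall>x. F z (R x) + w *\<^sub>C R x = x) \<and>
      (\<forall>x. R (F z x + w *\<^sub>C x) = x) \<and> (\<forall>x. norm (R x) \<le> norm x / \<bar>Im w\<bar>)" for z R
  have "\<exists>R. inverts z R" if z: "z \<in> ?S" for z
  proof -
    let ?a = "- \<i> * of_real (sgn (Im w))"
    have "cmod ?a = 1" using im by (simp add: norm_mult sgn_if)
    moreover have "\<bar>Im w\<bar> * (norm h)\<^sup>2 \<le> Re (?a * cinner h (F z h + w *\<^sub>C h))" for h
    proof -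
      have "0 \<le> sgn (Im w) * Im z * (norm (G z h))\<^sup>2" using z by simp
      moreover have "\<bar>Im w\<bar> = sgn (Im w) * Im w" by (simp add: sgn_if)
      ultimately show ?thesis
        by (simp add: cinner_add_right cinner_scaleC_right cinner_self imaginary_part[OF nr[OF z]] algebra_simps)
    qed
    moreover have "0 < \<bar>Im w\<bar>" using im by simp
    ultimately obtain R where "bounded_clinear R" "\<And>x. F z (R x) + w *\<^sub>C R x = x"
        "\<And>x. R (F z x + w *\<^sub>C x) = x" "\<And>x. norm (R x) \<le> norm x / \<bar>Im w\<bar>"
      using coercive_inverse[OF bounded_clinear_add_scalar[OF bounded_clinear_F[OF nr[OF z]]]] by metis
    then show ?thesis unfolding inverts_def by blast
  qed
  then obtain R where "\<forall>z\<in>?S. inverts z (R z)" using bchoice[of ?S inverts] by blast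
  then have R: "bounded_clinear (R z)" "F z (R z x) + w *\<^sub>C R z x = x" "R z (F z x + w *\<^sub>C x) = x"
      "norm (R z x) \<le> norm x / \<bar>Im w\<bar>" if "z \<in> ?S" for z x
    using that by (auto simp: inverts_def)
  show ?thesis
    unfolding operator_analytic_on_def
  proof (intro exI[of _ R] conjI ballI)
    fix z assume z: "z \<in> ?S"
    show "bounded_clinear (R z)" by (rule R(1)[OF z])
    show "(rel_add_scalar (graph_of (F z)) w)\<inverse> = graph_of (R z)"
    proof (intro set_eqI, clarify)
      fix x y
      have "(x, y) \<in> (rel_add_scalar (graph_of (F z)) w)\<inverse> \<longleftrightarrow> F z y + w *\<^sub>C y = x"
        by (auto simp: rel_add_scalar_def graph_of_def)
      also have "\<dots> \<longleftrightarrow> R z x = y" using R(2,3)[OF z] by metis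
      finally show "(x, y) \<in> (rel_add_scalar (graph_of (F z)) w)\<inverse> \<longleftrightarrow> (x, y) \<in> graph_of (R z)"
        by (auto simp: graph_of_def)
    qed
    obtain D where "operator_has_derivative F D z" using norm_differentiable[OF nr[OF z]] by blast
    then have "operator_has_derivative (\<lambda>u x. F u x + w *\<^sub>C x) D z"
      by (simp add: operator_has_derivative_def)
    moreover have "open ?S"
      by (intro open_Collect_less continuous_intros)
    ultimately have "operator_has_derivative R (\<lambda>x. (-1) *\<^sub>C R z (D (R z x))) z"
      by (rule operator_has_derivative_inverse[where c = "\<bar>Im w\<bar>"])
        (use z im R nr bounded_clinear_F in \<open>auto intro!: bounded_clinear_add_scalar\<close>)
    then show "\<exists>D. bounded_clinear D \<and>
        ((\<lambda>u. onorm (\<lambda>x. inverse (u - z) *\<^sub>C (R u x - R z x) - D x)) \<longlongrightarrow> 0) (at z)"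
      unfolding operator_has_derivative_def by blast
  qed
qed

lemma adjoint_graph:
  assumes z: "z \<notin> \<real>"
  shows "rel_adjoint (graph_of (F z)) = graph_of (F (cnj z))"
proof (intro set_eqI, clarify)
  fix k k'
  have "(k, k') \<in> rel_adjoint (graph_of (F z)) \<longleftrightarrow> (\<forall>h. cinner h k' = cinner h (F (cnj z) k))"
    by (auto simp: rel_adjoint_def graph_of_def cinner_cnj_argument[OF z])
  also have "\<dots> \<longleftrightarrow> k' = F (cnj z) k" using cinner_eqI by blast
  finally show "(k, k') \<in> rel_adjoint (graph_of (F z)) \<longleftrightarrow> (k, k') \<in> graph_of (F (cnj z))"
    by (auto simp: graph_of_def)
qed

lemma half_plane_maximal:
  assumes z: "z \<notin> \<real>" and "linear_relation N" "graph_of (F z) \<subseteq> N"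
    and "\<And>h h'. (h, h') \<in> N \<Longrightarrow> 0 \<le> Im z * Im (cinner h h')"
  shows "N = graph_of (F z)"
  using everywhere_defined_half_plane_maximal[of N "F z" "Im z"] assms by (auto simp: complex_is_Real_iff)

lemma nevanlinna_function:
  assumes M: "\<And>z. z \<notin> \<real> \<Longrightarrow> M z = graph_of (F z)"
  shows "M \<in> nevanlinna_functions"
proof -
  have lin: "linear_relation (M z)" if "z \<notin> \<real>" for z
    unfolding M[OF that] by (rule linear_relation_graph_of[OF bounded_clinear_F[OF that]])
  have im: "Im (cinner h h') = Im z * (norm (G z h))\<^sup>2" if "(h, h') \<in> M z" "z \<notin> \<real>" for z h h'
    using that M imaginary_part by (auto simp: graph_of_def)
  have "maximal_dissipative (M z)" if z: "Im z > 0" for z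
  proof -
    have nr: "z \<notin> \<real>" using z by (auto simp: complex_is_Real_iff)
    show ?thesis
      unfolding maximal_dissipative_def dissipative_def
    proof (intro conjI allI impI)
      show "\<forall>(h, h') \<in> M z. 0 \<le> Im (cinner h h')" using im[OF _ nr] z by auto
      fix N assume "(linear_relation N \<and> (\<forall>(h, h') \<in> N. 0 \<le> Im (cinner h h'))) \<and> M z \<subseteq> N"
      then show "N = M z" unfolding M[OF nr] using z by (intro half_plane_maximal[OF nr]) auto
    qed (rule lin[OF nr])
  qed
  moreover have "maximal_accumulative (M z)" if z: "Im z < 0" for z
  proof -
    have nr: "z \<notin> \<real>" using z by (auto simp: complex_is_Real_iff)
    show ?thesis
      unfolding maximal_accumulative_def accumulative_def
    proof (intro conjI allI impI)
      show "\<forall>(h, h') \<in> M z. Im (cinner h h') \<le> 0" using im[OF _ nr] z by (auto simp: mult_le_0_iff)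
      fix N assume "(linear_relation N \<and> (\<forall>(h, h') \<in> N. Im (cinner h h') \<le> 0)) \<and> M z \<subseteq> N"
      then show "N = M z" unfolding M[OF nr] using z by (intro half_plane_maximal[OF nr]) (auto simp: zero_le_mult_iff)
    qed (rule lin[OF nr])
  qed
  moreover have res: "operator_analytic_on (\<lambda>z. (rel_add_scalar (M z) w)\<inverse>) {z. 0 < sgn (Im w) * Im z}"
    if w: "w \<notin> \<real>" for w
  proof -
    have "z \<notin> \<real>" if "0 < sgn (Im w) * Im z" for z using that by (auto simp: complex_is_Real_iff)
    then show ?thesis using resolvent_analytic[OF w] M by (simp add: operator_analytic_on_def)
  qed
  moreover have "operator_analytic_on (\<lambda>z. (rel_add_scalar (M z) w)\<inverse>) {z. Im z > 0}" if "Im w > 0" for w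
    using res[of w] that by (auto simp: complex_is_Real_iff)
  moreover have "operator_analytic_on (\<lambda>z. (rel_add_scalar (M z) w)\<inverse>) {z. Im z < 0}" if "Im w < 0" for w
    using res[of w] that by (auto simp: complex_is_Real_iff)
  moreover have "rel_adjoint (M z) = M (cnj z)" if "z \<notin> \<real>" for z
    using that M[of z] M[of "cnj z"] adjoint_graph by (simp add: Reals_cnj_iff)
  moreover have "single_valued (M z) \<and> Domain (M z) = UNIV" if "z \<notin> \<real>" for z
    unfolding M[OF that] by (auto simp: graph_of_def single_valued_def)
  ultimately show ?thesis
    unfolding nevanlinna_functions_def nevanlinna_families_def by blast
qed

end

section \<open>Weyl families of isometric relations\<close>

lemma weyl_family_iff: "(h, h') \<in> weyl_family \<Gamma> z \<longleftrightarrow> (\<exists>f. ((f, z *\<^sub>C f), (h, h')) \<in> \<Gamma>)"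
proof
  assume "\<exists>f. ((f, z *\<^sub>C f), (h, h')) \<in> \<Gamma>"
  then obtain f where f: "((f, z *\<^sub>C f), (h, h')) \<in> \<Gamma>" ..
  then have "f \<in> defect_space (Domain \<Gamma>) z"
    by (force simp: defect_space_def rel_ker_def rel_add_scalar_def)
  then have "(f, z *\<^sub>C f) \<in> defect_relation (Domain \<Gamma>) z" by (auto simp: defect_relation_def)
  then show "(h, h') \<in> weyl_family \<Gamma> z" unfolding weyl_family_def using f by (rule ImageI[rotated])
qed (auto simp: weyl_family_def defect_relation_def)

lemma weyl_family_mono: "\<Gamma> \<subseteq> \<Delta> \<Longrightarrow> weyl_family \<Gamma> z \<subseteq> weyl_family \<Delta> z"
  by (rule subrelI) (unfold weyl_family_iff, blast)

lemma krein_isometric_green: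
  assumes "\<Gamma>\<inverse> \<subseteq> krein_adjoint \<Gamma>"
    and "((f, z *\<^sub>C f), (h, h')) \<in> \<Gamma>" "((g, w *\<^sub>C g), (k, k')) \<in> \<Gamma>"
  shows "(w - cnj z) * cinner f g = cinner h k' - cinner h' k"
proof -
  have "krein (f, z *\<^sub>C f) (g, w *\<^sub>C g) = krein (h, h') (k, k')"
    using assms by (force simp: krein_adjoint_def)
  then have "cinner f (w *\<^sub>C g) - cinner (z *\<^sub>C f) g = cinner h k' - cinner h' k"
    by (simp add: krein_def)
  then show ?thesis
    by (simp add: cinner_scaleC_left cinner_scaleC_right left_diff_distrib)
qed

theorem corollary1p2:
  fixes A :: "('a::complex_hilbert \<times> 'a) set"
    and \<Gamma> :: "(('a \<times> 'a) \<times> ('b::complex_hilbert \<times> 'b)) set"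
  assumes "linear_relation A" and "closed A" and "symmetric_relation A"
    and "essentially_unitary_boundary_pair A \<Gamma>"
    and "\<And>z. z \<notin> \<real> \<Longrightarrow> weyl_family \<Gamma> z \<in> bounded_operators"
  shows "(\<forall>z. z \<notin> \<real> \<longrightarrow> weyl_family \<Gamma> z = weyl_family (closure \<Gamma>) z) \<and>
         weyl_family \<Gamma> \<in> nevanlinna_functions"
proof -
  have isometric: "(closure \<Gamma>)\<inverse> \<subseteq> krein_adjoint (closure \<Gamma>)"
    using assms(4) unfolding krein_adjoint_closure
    by (simp add: essentially_unitary_boundary_pair_def krein_essentially_unitary_def)
  have "\<exists>F. bounded_clinear F \<and> weyl_family \<Gamma> z = graph_of F" if "z \<notin> \<real>" for z
    using assms(5)[OF that] by (auto simp: bounded_operators_def)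
  then obtain F where F: "\<And>z. z \<notin> \<real> \<Longrightarrow> bounded_clinear (F z)"
      "\<And>z. z \<notin> \<real> \<Longrightarrow> weyl_family \<Gamma> z = graph_of (F z)"
    by metis
  have "\<exists>f. ((f, z *\<^sub>C f), (h, F z h)) \<in> closure \<Gamma>" if "z \<notin> \<real>" for z h
  proof -
    have "(h, F z h) \<in> weyl_family \<Gamma> z" by (simp add: F(2)[OF that] graph_of_def)
    then show ?thesis using closure_subset[of \<Gamma>] by (auto simp: weyl_family_iff)
  qed
  then obtain G where G: "\<And>z h. z \<notin> \<real> \<Longrightarrow> ((G z h, z *\<^sub>C G z h), (h, F z h)) \<in> closure \<Gamma>"
    by metis
  interpret green_family F G
    by unfold_locales (use F(1) krein_isometric_green[OF isometric G G] in auto)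
  have "weyl_family \<Gamma> z = weyl_family (closure \<Gamma>) z" if z: "z \<notin> \<real>" for z
  proof
    show "weyl_family \<Gamma> z \<subseteq> weyl_family (closure \<Gamma>) z"
      by (rule weyl_family_mono[OF closure_subset])
    show "weyl_family (closure \<Gamma>) z \<subseteq> weyl_family \<Gamma> z"
    proof clarify
      fix h h' assume "(h, h') \<in> weyl_family (closure \<Gamma>) z"
      then obtain f where f: "((f, z *\<^sub>C f), (h, h')) \<in> closure \<Gamma>" by (auto simp: weyl_family_iff)
      have cz: "cnj z \<notin> \<real>" using z by (simp add: Reals_cnj_iff)
      \<comment> \<open>At \<open>cnj z\<close> and \<open>z\<close> the factor on the left of Green's identity is zero.\<close>
      have "cinner k h' = cinner k (F z h)" for k
        using krein_isometric_green[OF isometric G[OF cz, of k] f] cinner_cnj_argument[OF cz, of k h] by simp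
      then have "h' = F z h" by (rule cinner_eqI)
      then show "(h, h') \<in> weyl_family \<Gamma> z" by (simp add: F(2)[OF z] graph_of_def)
    qed
  qed
  moreover have "weyl_family \<Gamma> \<in> nevanlinna_functions"
    by (rule nevanlinna_function[OF F(2)])
  ultimately show ?thesis by blast
qed

end
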